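(* Let $m\ge2$. For any $\eta,q\in\Delta_m$, $$B^{\mathrm{zo}}(\eta,q)\le\|\eta-q\|_{\infty2},$$ where $\|b\|_{\infty2}=\max_{j\ne k\in\{1,\ldots,m\}}(|b_j|+|b_k|)$ for any vector $b=(b_1,\ldots,b_m)^{T}$. The bound is tight for any $m\ge2$ in that there exist $\eta,q\in\Delta_m$ for which the bound becomes exact (equality).
   Context: $\Delta_m=\{q\in\mathbb R^m: q_j\ge0,\ \sum_jq_j=1\}$. The zero-one loss is $L^{\mathrm{zo}}(j,q)=1\{j\ne\mathrm{argmax}_kq_k\}$, where argmax is a single index of a maximum component, ties broken by any fixed rule. Its regret is $B^{\mathrm{zo}}(\eta,q)=\sum_j\eta_jL^{\mathrm{zo}}(j,q)-(1-\max_k\eta_k)=\max_k\eta_k-\eta_l$ with $l=\mathrm{argmax}_kq_k$. *)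

theory Defs
  imports "HOL-Analysis.Analysis"
begin

definition prob_simplex :: "(real ^ 'm) set" where
  "prob_simplex = {q. (\<forall>j. q $ j \<ge> 0) \<and> (\<Sum>j\<in>UNIV. q $ j) = 1}"

(* A tie-breaking rule is an arbitrary selection of one index of a maximum component. *)
definition argmax_rule :: "(real ^ 'm \<Rightarrow> 'm) \<Rightarrow> bool" where
  "argmax_rule am \<longleftrightarrow> (\<forall>q\<in>prob_simplex. q $ am q = (MAX k. q $ k))"

definition zo_loss :: "(real ^ 'm \<Rightarrow> 'm) \<Rightarrow> 'm \<Rightarrow> real ^ 'm \<Rightarrow> real" where
  "zo_loss am j q = (if j \<noteq> am q then 1 else 0)"

definition zo_regret :: "(real ^ 'm \<Rightarrow> 'm) \<Rightarrow> real ^ 'm \<Rightarrow> real ^ 'm \<Rightarrow> real" where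
  "zo_regret am \<eta> q = (\<Sum>j\<in>UNIV. \<eta> $ j * zo_loss am j q) - (1 - (MAX k. \<eta> $ k))"

(* Meaningful only for at least two coordinates, since otherwise the set is empty. *)
definition norm_inf2 :: "real ^ 'm \<Rightarrow> real" where
  "norm_inf2 b = Max {\<bar>b $ j\<bar> + \<bar>b $ k\<bar> | j k. j \<noteq> k}"

lemma zo_regret_eq:
  fixes \<eta> q :: "real ^ 'm"
  assumes "\<eta> \<in> prob_simplex"
  shows "zo_regret am \<eta> q = (MAX k. \<eta> $ k) - \<eta> $ am q"
proof -
  have "(\<Sum>j\<in>UNIV. \<eta> $ j * zo_loss am j q) = (\<Sum>j\<in>UNIV. \<eta> $ j - (if j = am q then \<eta> $ j else 0))"
    by (rule sum.cong) (auto simp: zo_loss_def)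
  also have "\<dots> = 1 - \<eta> $ am q"
    using assms by (simp add: sum_subtractf prob_simplex_def)
  finally show ?thesis by (simp add: zo_regret_def)
qed

end

theory Submission
  imports Defs
begin

text \<open>If \<open>k\<close> maximises \<open>\<eta>\<close> and \<open>l = argmax q\<close>, then \<open>q\<^sub>k \<le> q\<^sub>l\<close>, so
  \<open>\<eta>\<^sub>k - \<eta>\<^sub>l \<le> (\<eta>\<^sub>k - q\<^sub>k) + (q\<^sub>l - \<eta>\<^sub>l)\<close>. The choice \<open>\<eta> = q\<close> already gives the
  equality \<open>0 = 0\<close>; the witness below attains the value 1 instead, by letting \<open>q\<close> be uniform on
  two indices and \<open>\<eta>\<close> the point mass at the one that the tie-breaking rule does not select.\<close>

lemma finite_norm_inf2_set:
  fixes b :: "real ^ 'm"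
  shows "finite {\<bar>b $ j\<bar> + \<bar>b $ k\<bar> | j k. j \<noteq> k}"
  by (rule finite_subset[of _ "(\<lambda>(j, k). \<bar>b $ j\<bar> + \<bar>b $ k\<bar>) ` UNIV"]) auto

lemma norm_inf2_ge:
  fixes b :: "real ^ 'm"
  assumes "j \<noteq> k"
  shows "\<bar>b $ j\<bar> + \<bar>b $ k\<bar> \<le> norm_inf2 b"
  unfolding norm_inf2_def using assms by (intro Max_ge finite_norm_inf2_set) blast

text \<open>Two distinct indices make the set under \<open>Max\<close> nonempty, so a common bound
  on its elements passes to the maximum.\<close>

lemma norm_inf2_le:
  fixes b :: "real ^ 'm"
  assumes "CARD('m) \<ge> 2" and "\<And>j k. j \<noteq> k \<Longrightarrow> \<bar>b $ j\<bar> + \<bar>b $ k\<bar> \<le> c"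
  shows "norm_inf2 b \<le> c"
proof -
  obtain j k :: 'm where "j \<noteq> k"
    using assms(1) by (auto simp: numeral_2_eq_2 card_le_Suc_iff)
  then have "{\<bar>b $ j\<bar> + \<bar>b $ k\<bar> | j k. j \<noteq> k} \<noteq> {}"
    by blast
  then show ?thesis
    unfolding norm_inf2_def using assms(2) by (auto simp: Max_le_iff[OF finite_norm_inf2_set])
qed

lemma norm_inf2_nonneg:
  fixes b :: "real ^ 'm"
  assumes "CARD('m) \<ge> 2"
  shows "0 \<le> norm_inf2 b"
proof -
  obtain j k :: 'm where "j \<noteq> k"
    using assms by (auto simp: numeral_2_eq_2 card_le_Suc_iff)
  from norm_inf2_ge[OF this, of b] show ?thesis
    by linarith
qed

lemma argmax_rule_ge:
  fixes q :: "real ^ 'm"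
  assumes "argmax_rule am" and "q \<in> prob_simplex"
  shows "q $ k \<le> q $ am q"
  using assms by (simp add: argmax_rule_def)

lemma zo_regret_le_norm_inf2:
  fixes \<eta> q :: "real ^ 'm"
  assumes "CARD('m) \<ge> 2" and "argmax_rule am"
    and "\<eta> \<in> prob_simplex" and "q \<in> prob_simplex"
  shows "zo_regret am \<eta> q \<le> norm_inf2 (\<eta> - q)"
proof -
  have "(MAX k. \<eta> $ k) \<in> range (($) \<eta>)"
    by (rule Max_in) auto
  then obtain k where k: "(MAX k. \<eta> $ k) = \<eta> $ k"
    by (rule rangeE)
  \<comment> \<open>\<open>norm_inf2\<close> ranges over pairs of distinct indices only, so
    \<open>k\<close> and \<open>am q\<close> form such a pair unless they coincide, and then the
    regret is 0.\<close>
  show ?thesis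
  proof (cases "k = am q")
    case True
    with k norm_inf2_nonneg[OF assms(1)] show ?thesis
      by (simp add: zo_regret_eq[OF assms(3)])
  next
    case False
    from norm_inf2_ge[OF this, of "\<eta> - q"] argmax_rule_ge[OF assms(2,4), of k]
    show ?thesis
      by (simp add: zo_regret_eq[OF assms(3)] k)
  qed
qed

lemma zo_regret_eq_norm_inf2_witness:
  fixes am :: "real ^ 'm \<Rightarrow> 'm"
  assumes card: "CARD('m) \<ge> 2" and am: "argmax_rule am"
  obtains \<eta> q where "\<eta> \<in> prob_simplex" "q \<in> prob_simplex"
    "zo_regret am \<eta> q = 1" "norm_inf2 (\<eta> - q) = 1"
proof -
  obtain a b :: 'm where ab: "a \<noteq> b"
    using card by (auto simp: numeral_2_eq_2 card_le_Suc_iff)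
  \<comment> \<open>\<open>q\<close> is fixed without consulting the rule; \<open>\<eta>\<close> is
    chosen afterwards, according to how the rule breaks the tie.\<close>
  define q :: "real ^ 'm" where "q = (\<chi> i. if i \<in> {a, b} then 1 / 2 else 0)"
  have "(\<Sum>i\<in>UNIV. q $ i) = (\<Sum>i\<in>{a, b}. q $ i)"
    by (rule sum.mono_neutral_right) (auto simp: q_def)
  with ab have q: "q \<in> prob_simplex"
    by (simp add: prob_simplex_def q_def)
  \<comment> \<open>The selected component is positive and \<open>q\<close> vanishes off
    \<open>{a, b}\<close>, so the rule must pick \<open>a\<close> or \<open>b\<close>.\<close>
  have "q $ am q \<ge> 1 / 2"
    using argmax_rule_ge[OF am q, of a] by (simp add: q_def)
  then have "am q \<in> {a, b}"
    by (auto simp: q_def split: if_splits)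
  with ab obtain k where k: "k \<noteq> am q" "{a, b} = {k, am q}"
    by (metis insertE insert_commute singletonD)
  define \<eta> :: "real ^ 'm" where "\<eta> = axis k 1"
  have \<eta>: "\<eta> \<in> prob_simplex"
    by (simp add: prob_simplex_def \<eta>_def axis_def)
  have "(MAX i. \<eta> $ i) = 1"
    by (rule Max_eqI) (auto simp: \<eta>_def axis_def)
  moreover have "\<eta> $ am q = 0"
    using k(1) by (simp add: \<eta>_def axis_def)
  ultimately have regret: "zo_regret am \<eta> q = 1"
    by (simp add: zo_regret_eq[OF \<eta>])
  \<comment> \<open>The difference is 1/2 at \<open>k\<close>, -1/2 at \<open>am q\<close> and 0
    elsewhere.\<close>
  have "\<bar>(\<eta> - q) $ i\<bar> \<le> 1 / 2" for i
  proof -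
    have "q $ k = 1 / 2" "i \<noteq> k \<Longrightarrow> q $ i \<in> {0, 1 / 2}"
      using k(2) by (auto simp: q_def)
    then show ?thesis
      by (cases "i = k") (auto simp: \<eta>_def axis_def)
  qed
  then have "norm_inf2 (\<eta> - q) \<le> 1 / 2 + 1 / 2"
    by (intro norm_inf2_le[OF card] add_mono)
  \<comment> \<open>The lower bound on the norm is the general inequality itself, since the regret
    is already 1.\<close>
  with zo_regret_le_norm_inf2[OF card am \<eta> q] regret have "norm_inf2 (\<eta> - q) = 1"
    by simp
  with that \<eta> q regret show thesis
    by blast
qed

theorem lemma5:
  fixes am :: "real ^ 'm \<Rightarrow> 'm"
  assumes "CARD('m) \<ge> 2"
    and "argmax_rule am"
  shows "(\<forall>\<eta>\<in>prob_simplex. \<forall>q\<in>prob_simplex. zo_regret am \<eta> q \<le> norm_inf2 (\<eta> - q)) \<and>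
         (\<exists>\<eta>\<in>prob_simplex. \<exists>q\<in>prob_simplex. zo_regret am \<eta> q = norm_inf2 (\<eta> - q))"
  using zo_regret_le_norm_inf2[OF assms] zo_regret_eq_norm_inf2_witness[OF assms] by metis

end
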